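(* Let $k$ be an algebraically closed field, let $q\in k^*$, and let $F\in GL(n,k)$ with $n\ge 2$. Assume that $$q^2+\operatorname{tr}\bigl(F\,({}^tF)^{-1}\bigr)\,q+1=0 .$$ Then $\mathcal B(E_q,F)$ is a non-zero algebra.
   Context: ${}^tx$ denotes the transpose of a matrix $x$ (with $({}^tx)_{ij}=x_{ji}$). For $q\in k^*$, $E_q=\begin{pmatrix}0&1\\-q^{-1}&0\end{pmatrix}\in GL(2,k)$. For $E\in GL(m,k)$ and $F\in GL(n,k)$, $\mathcal B(E,F)$ is the universal $k$-algebra with generators $z_{ij}$, $1\le i\le m$, $1\le j\le n$, and relations $F^{-1}\,{}^tz\,E\,z=I_n$ and $z\,F^{-1}\,{}^tz\,E=I_m$, where $z=(z_{ij})$. *)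

theory Defs
  imports
    "HOL-Analysis.Analysis"
    "HOL-Algebra.Algebraic_Closure_Type"
    "HOL-Library.Poly_Mapping"
begin

text \<open>
  The free monoid on \<open>'x\<close>, written additively because the convolution product of
  \<open>\<Rightarrow>\<^sub>0\<close> is defined for additive index monoids. Addition is concatenation and is
  not commutative.
\<close>

datatype 'x free_word = Word (letters: "'x list")

instantiation free_word :: (type) monoid_add
begin

definition zero_free_word :: "'a free_word" where
  "0 = Word []"

definition plus_free_word :: "'a free_word \<Rightarrow> 'a free_word \<Rightarrow> 'a free_word" where
  "u + v = Word (letters u @ letters v)"

instance
  by standard (simp_all add: zero_free_word_def plus_free_word_def)

end

text \<open>The free associative unital \<open>'k\<close>-algebra on \<open>'x\<close>, as the monoid algebra of the free monoid.\<close>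

type_synonym ('x, 'k) free_algebra = "'x free_word \<Rightarrow>\<^sub>0 'k"

definition free_gen :: "'x \<Rightarrow> ('x, 'k::field) free_algebra" where
  "free_gen x = Poly_Mapping.single (Word [x]) 1"

definition free_scalar :: "'k::field \<Rightarrow> ('x, 'k) free_algebra" where
  "free_scalar c = Poly_Mapping.single 0 c"

definition scalar_matrix :: "'k::field^'n^'m \<Rightarrow> ('x, 'k) free_algebra^'n^'m" where
  "scalar_matrix M = (\<chi> i j. free_scalar (M $ i $ j))"

definition gen_matrix :: "('m \<times> 'n, 'k::field) free_algebra^'n^'m" where
  "gen_matrix = (\<chi> i j. free_gen (i, j))"

definition bilin_relations ::
  "'k::field^'m^'m \<Rightarrow> 'k^'n^'n \<Rightarrow> ('m \<times> 'n, 'k) free_algebra set" where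
  "bilin_relations E F =
    (let z = gen_matrix;
         tz = Finite_Cartesian_Product.transpose z;
         E' = scalar_matrix E;
         Finv = scalar_matrix (matrix_inv F)
     in {(Finv ** tz ** E' ** z - mat 1) $ i $ j | i j. True} \<union>
        {(z ** Finv ** tz ** E' - mat 1) $ i $ j | i j. True})"

definition bilin_ideal ::
  "'k::field^'m^'m \<Rightarrow> 'k^'n^'n \<Rightarrow> ('m \<times> 'n, 'k) free_algebra set" where
  "bilin_ideal E F = Idl\<^bsub>ring_of_type_algebra\<^esub> (bilin_relations E F)"

text \<open>
  \<open>\<B>(E,F)\<close> is the free algebra modulo the two-sided ideal generated by the relations
  (ideals in HOL-Algebra are two-sided). Being presented by generators and relations it
  has the universal property. Here the type \<open>module\<close> is the HOL-Algebra record type of a ring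
  together with a scalar multiplication; the scalar \<open>c\<close> acts on a coset as
  multiplication by the coset of \<open>c\<close>.
\<close>

definition bilin_algebra ::
  "'k::field^'m^'m \<Rightarrow> 'k^'n^'n \<Rightarrow> ('k, ('m \<times> 'n, 'k) free_algebra set) module" where
  "bilin_algebra E F =
    ring.extend (ring_of_type_algebra Quot bilin_ideal E F)
      (module.fields (\<lambda>c S. rcoset_mult ring_of_type_algebra (bilin_ideal E F)
        (bilin_ideal E F +>\<^bsub>ring_of_type_algebra\<^esub> free_scalar c) S))"

definition E_mat :: "'k::field \<Rightarrow> 'k^2^2" where
  "E_mat q = vector [vector [0, 1], vector [- inverse q, 0]]"

end

theory Submission
  imports Defs
begin

text \<open>
  Write \<open>x\<^sub>j = z\<^sub>1\<^sub>j\<close>, \<open>y\<^sub>j = z\<^sub>2\<^sub>j\<close> and \<open>G = F\<^bsup>-1\<^esup>\<close>. The defining relations of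
  \<open>\<B>(E\<^sub>q, F)\<close> then say \<open>y\<^sub>j x\<^sub>k = q x\<^sub>j y\<^sub>k - q F\<^sub>j\<^sub>k\<close> together with
  \<open>xGx = 0\<close>, \<open>xGy = -q\<close>, \<open>yGx = 1\<close>, \<open>yGy = 0\<close>, where for instance \<open>xGy\<close> is
  \<open>\<Sum> G\<^sub>a\<^sub>b x\<^sub>a y\<^sub>b\<close>. The first relation and \<open>xGy = -q\<close> force \<open>yGx = -q\<^sup>2 - tq\<close> with
  \<open>t = tr(F (\<^sup>tF)\<^bsup>-1\<^esup>)\<close>, so the hypothesis on \<open>q\<close> is exactly what makes the system consistent.

  The algebra is non-zero because it has a non-zero module \<open>M\<close>. In \<open>M\<close> there are vectors
  \<open>v\<^sub>0, v\<^sub>1, \<dots>\<close> on which the \<open>y\<^sub>j\<close> act as scalars up to a shift, \<open>y\<^sub>j v\<^sub>i = c\<^sub>i\<^sub>j v\<^sub>i\<^sub>+\<^sub>1\<close>, and the \<open>x\<^sub>j\<close> act as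
  freely as the relations permit. On such vectors \<open>yGy = 0\<close> becomes the orthogonality of
  consecutive coefficient vectors, \<open>c\<^sub>i\<^sub>+\<^sub>1 G c\<^sub>i = 0\<close>, and \<open>xGy = -q\<close> becomes
  \<open>\<Sum> (G c\<^sub>i)\<^sub>a x\<^sub>a v\<^sub>i\<^sub>+\<^sub>1 = -q v\<^sub>i\<close>.

  For \<open>M\<close> to have an evident basis, \<open>xGx = 0\<close> must become a terminating rewrite rule without overlaps.
  An isotropic vector of \<open>G\<close>, which exists since \<open>k\<close> is algebraically closed and \<open>n \<ge> 2\<close>, provides
  a basis of \<open>k\<^sup>n\<close> in which some row \<open>\<omega>\<close> of \<open>G\<close> is the coordinate vector of some \<open>\<alpha> \<noteq> \<omega>\<close>
  (\<open>normalizing_basis\<close>). Then \<open>xGx = 0\<close> expresses \<open>x\<^sub>\<omega> x\<^sub>\<alpha>\<close> through products whose first letter is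
  not \<open>x\<^sub>\<omega>\<close>, and with \<open>c\<^sub>i\<^sub>\<alpha> = 1\<close> the rule for \<open>v\<^sub>i\<^sub>+\<^sub>1\<close> expresses \<open>x\<^sub>\<omega> v\<^sub>i\<^sub>+\<^sub>1\<close> through \<open>v\<^sub>i\<close> and such
  products. The words
  in the \<open>x\<^sub>j\<close> followed by some \<open>v\<^sub>i\<close> to which neither rule applies form a basis. The heart of the proof is
  \<open>opY_opX_commute\<close>: the relation between \<open>y\<^sub>j\<close> and \<open>x\<^sub>k\<close>, which defines \<open>y\<^sub>j\<close> on words,
  survives the rewriting, and this is where the quadratic equation for \<open>q\<close> enters.

  Everything is phrased on the dual of \<open>M\<close>, that is, on all functions on the basis. There an
  operator is a recursive function, and a product of generators acts by the composition in
  the opposite order.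
\<close>

(* Below, $ always selects an entry of a vector or matrix. *)
no_notation fps_nth (infixl \<open>$\<close> 75)

section \<open>Linear operators on functions\<close>

definition linear_op :: "(('s \<Rightarrow> 'k::field) \<Rightarrow> 's \<Rightarrow> 'k) \<Rightarrow> bool" where
  "linear_op T \<longleftrightarrow> (\<forall>a b f g s. T (\<lambda>u. a * f u + b * g u) s = a * T f s + b * T g s)"

lemma linear_op_combine:
  "linear_op T \<Longrightarrow> T (\<lambda>u. a * f u + b * g u) s = a * T f s + b * T g s"
  by (simp add: linear_op_def)

lemma linear_op_add: "linear_op T \<Longrightarrow> T (\<lambda>u. f u + g u) s = T f s + T g s"
  using linear_op_combine[of T 1 f 1 g s] by simp

lemma linear_op_diff: "linear_op T \<Longrightarrow> T (\<lambda>u. f u - g u) s = T f s - T g s"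
  using linear_op_combine[of T 1 f "-1" g s] by simp

lemma linear_op_scale: "linear_op T \<Longrightarrow> T (\<lambda>u. a * f u) s = a * T f s"
  using linear_op_combine[of T a f 0 f s] by simp

lemma linear_op_zero: "linear_op T \<Longrightarrow> T (\<lambda>u. 0) s = 0"
  using linear_op_scale[of T 0 "\<lambda>u. 0" s] by simp

lemma linear_op_sum: "linear_op T \<Longrightarrow> T (\<lambda>u. \<Sum>x\<in>A. h x u) s = (\<Sum>x\<in>A. T (h x) s)"
proof (induction A rule: infinite_finite_induct)
  case (insert x A)
  then show ?case
    using linear_op_add[of T "h x" "\<lambda>u. \<Sum>x\<in>A. h x u" s] by simp
qed (simp_all add: linear_op_zero)

section \<open>A criterion for the algebra to be non-zero\<close>

definition run :: "('x \<Rightarrow> ('s \<Rightarrow> 'k::field) \<Rightarrow> 's \<Rightarrow> 'k) \<Rightarrow> 'x free_word \<Rightarrow> ('s \<Rightarrow> 'k) \<Rightarrow> 's \<Rightarrow> 'k" where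
  "run T w = fold T (letters w)"

text \<open>
  A free algebra acts on functions by letting a word apply the operators of its letters from left to right.
  This is a right action, hence the reversed order in \<open>act_mult\<close>.
\<close>

definition act :: "('x \<Rightarrow> ('s \<Rightarrow> 'k::field) \<Rightarrow> 's \<Rightarrow> 'k) \<Rightarrow> ('x, 'k) free_algebra \<Rightarrow> ('s \<Rightarrow> 'k) \<Rightarrow> 's \<Rightarrow> 'k" where
  "act T p f s = (\<Sum>w\<in>Poly_Mapping.keys p. Poly_Mapping.lookup p w * run T w f s)"

lemma run_zero: "run T 0 f = f"
  by (simp add: run_def zero_free_word_def)

lemma run_plus: "run T (v + w) f = run T w (run T v f)"
  by (simp add: run_def plus_free_word_def)

lemma act_superset:
  "finite A \<Longrightarrow> Poly_Mapping.keys p \<subseteq> A \<Longrightarrow>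
    act T p f s = (\<Sum>w\<in>A. Poly_Mapping.lookup p w * run T w f s)"
  unfolding act_def by (rule sum.mono_neutral_left) (auto simp: in_keys_iff)

lemma act_single: "act T (Poly_Mapping.single w a) f s = a * run T w f s"
  by (subst act_superset[of "{w}"]) auto

lemma act_zero: "act T 0 f s = 0"
  by (simp add: act_def)

lemma act_add: "act T (p + r) f s = act T p f s + act T r f s"
  using Poly_Mapping.keys_add[of p r]
  by (simp add: act_superset[of "Poly_Mapping.keys p \<union> Poly_Mapping.keys r"]
      lookup_add algebra_simps sum.distrib)

lemma act_uminus: "act T (- p) f s = - act T p f s"
  using act_add[of T p "- p" f s] by (simp add: act_zero eq_neg_iff_add_eq_0 add.commute)

lemma act_diff: "act T (p - r) f s = act T p f s - act T r f s"
  using act_add[of T p "- r" f s] by (simp add: act_uminus)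

lemma act_sum: "act T (\<Sum>x\<in>A. h x) f s = (\<Sum>x\<in>A. act T (h x) f s)"
  by (induction A rule: infinite_finite_induct) (simp_all add: act_zero act_add)

lemma act_one: "act T 1 f s = f s"
  using act_single[of T 0 1 f s] by (simp add: run_zero)

lemma act_scalar: "act T (free_scalar a) f s = a * f s"
  by (simp add: free_scalar_def act_single run_zero)

lemma act_gen: "act T (free_gen x) f s = T x f s"
  by (simp add: free_gen_def act_single run_def)

lemma run_linear:
  assumes "\<And>x. linear_op (T x)"
  shows "linear_op (run T w)"
proof -
  have "linear_op (fold T xs)" for xs
  proof (induction xs)
    case Nil
    then show ?case by (simp add: linear_op_def)
  next
    case (Cons x xs)
    have "T x (\<lambda>u. a * f u + b * g u) = (\<lambda>u. a * T x f u + b * T x g u)" for a b f g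
      by (rule ext) (rule linear_op_combine[OF assms])
    then show ?case using Cons.IH by (simp add: linear_op_def)
  qed
  then show ?thesis by (simp add: run_def)
qed

lemma act_linear:
  assumes "\<And>x. linear_op (T x)"
  shows "linear_op (act T p)"
  unfolding linear_op_def act_def
  by (simp add: linear_op_combine[OF run_linear[OF assms]] algebra_simps sum.distrib sum_distrib_left)

lemma free_algebra_induct [case_names zero step]:
  fixes p :: "('x, 'k::field) free_algebra"
  assumes "P 0" and "\<And>w a p. P p \<Longrightarrow> P (Poly_Mapping.single w a + p)"
  shows "P p"
proof (induction p rule: update_induct)
  case const
  then show ?case using assms(1) by simp
next
  case (update f w a)
  then have "Poly_Mapping.update w a f = Poly_Mapping.single w a + f"
    by (intro poly_mapping_eqI) (auto simp: lookup_update lookup_add lookup_single in_keys_iff when_def)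
  then show ?case using assms(2) update by simp
qed

lemma act_mult:
  assumes "\<And>x. linear_op (T x)"
  shows "act T (p * r) f s = act T r (act T p f) s"
proof (induction p rule: free_algebra_induct)
  case zero
  have "act T 0 f = (\<lambda>u. 0)" by (rule ext) (rule act_zero)
  then show ?case by (simp add: act_zero linear_op_zero[OF act_linear[OF assms]])
next
  case (step v a p)
  have single: "act T (Poly_Mapping.single v a * r) f s = a * act T r (run T v f) s" for r
  proof (induction r rule: free_algebra_induct)
    case zero
    then show ?case by (simp add: act_zero)
  next
    case (step w b r)
    then show ?case
      by (simp add: distrib_left act_add mult_single act_single run_plus)
  qed
  have "act T (Poly_Mapping.single v a + p) f = (\<lambda>u. a * run T v f u + 1 * act T p f u)"
    by (rule ext) (simp add: act_add act_single)
  then have "act T r (act T (Poly_Mapping.single v a + p) f) s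
      = a * act T r (run T v f) s + act T r (act T p f) s"
    by (simp only: linear_op_combine[OF act_linear[OF assms]]) simp
  moreover have "act T ((Poly_Mapping.single v a + p) * r) f s
      = a * act T r (run T v f) s + act T r (act T p f) s"
    by (simp add: distrib_right act_add single step)
  ultimately show ?case by simp
qed

text \<open>
  The operator descends to the functions on \<open>D\<close>. This allows a module with basis \<open>D\<close> to be described by
  operators on the functions on a whole type.
\<close>

definition restrictable :: "'s set \<Rightarrow> (('s \<Rightarrow> 'k) \<Rightarrow> 's \<Rightarrow> 'k) \<Rightarrow> bool" where
  "restrictable D T \<longleftrightarrow> (\<forall>f g. (\<forall>u\<in>D. f u = g u) \<longrightarrow> (\<forall>s\<in>D. T f s = T g s))"

lemma restrictableD:
  "restrictable D T \<Longrightarrow> (\<And>u. u \<in> D \<Longrightarrow> f u = g u) \<Longrightarrow> s \<in> D \<Longrightarrow> T f s = T g s"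
  unfolding restrictable_def by (erule allE[where x = f], erule allE[where x = g]) simp

lemma run_cong:
  assumes "\<And>x. restrictable D (T x)"
    and "\<And>u. u \<in> D \<Longrightarrow> f u = g u" and "s \<in> D"
  shows "run T w f s = run T w g s"
proof -
  have "fold T xs f s = fold T xs g s" if "\<And>u. u \<in> D \<Longrightarrow> f u = g u" for xs f g
    using that
  proof (induction xs arbitrary: f g)
    case Nil
    then show ?case using assms(3) by simp
  next
    case (Cons x xs)
    have "T x f u = T x g u" if "u \<in> D" for u
      by (rule restrictableD[OF assms(1) Cons.prems that])
    then have "fold T xs (T x f) s = fold T xs (T x g) s" by (rule Cons.IH)
    then show ?case by simp
  qed
  then show ?thesis unfolding run_def using assms(2) by this
qed

lemma ring_of_type_algebra_ring: "ring (ring_of_type_algebra :: 'a::ring_1 ring)"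
proof (rule ringI)
  show "abelian_group (ring_of_type_algebra :: 'a ring)"
  proof (rule abelian_groupI)
    fix x :: 'a
    show "\<exists>y\<in>carrier ring_of_type_algebra. y \<oplus>\<^bsub>ring_of_type_algebra\<^esub> x = \<zero>\<^bsub>ring_of_type_algebra\<^esub>"
      by (rule bexI[of _ "- x"]) (simp_all add: ring_of_type_algebra_def)
  qed (simp_all add: ring_of_type_algebra_def add_ac)
  show "Group.monoid (ring_of_type_algebra :: 'a ring)"
    by (rule Group.monoidI) (simp_all add: ring_of_type_algebra_def mult.assoc)
qed (simp_all add: ring_of_type_algebra_def distrib_left distrib_right)

definition annihilator :: "('x \<Rightarrow> ('s \<Rightarrow> 'k::field) \<Rightarrow> 's \<Rightarrow> 'k) \<Rightarrow> 's set \<Rightarrow> ('x, 'k) free_algebra set" where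
  "annihilator T D = {p. \<forall>f. \<forall>s\<in>D. act T p f s = 0}"

text \<open>
  Closure under multiplication from one side is clear; on the other side, the factor is applied to a function
  that vanishes on \<open>D\<close>, and the operators do not see values outside \<open>D\<close>.
\<close>

lemma annihilator_ideal:
  fixes T :: "'x \<Rightarrow> ('s \<Rightarrow> 'k::field) \<Rightarrow> 's \<Rightarrow> 'k"
  assumes lin: "\<And>x. linear_op (T x)"
    and restr: "\<And>x. restrictable D (T x)"
  shows "ideal (annihilator T D) (ring_of_type_algebra :: ('x, 'k) free_algebra ring)"
    (is "ideal ?J ?R")
proof (rule idealI)
  show "ring ?R" by (rule ring_of_type_algebra_ring)
  then interpret R: ring ?R .
  show "subgroup ?J (add_monoid ?R)"
  proof (rule R.add.subgroupI)
    show "?J \<noteq> {}" by (auto simp: annihilator_def intro!: exI[of _ 0] act_zero)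
    fix a b assume ab: "a \<in> ?J"
    have "a \<oplus>\<^bsub>?R\<^esub> (- a) = \<zero>\<^bsub>?R\<^esub>" by (simp add: ring_of_type_algebra_def)
    then have "\<ominus>\<^bsub>?R\<^esub> a = - a"
      by (intro R.minus_equality) (auto simp: ring_of_type_algebra_def)
    then show "\<ominus>\<^bsub>?R\<^esub> a \<in> ?J"
      using ab by (simp add: annihilator_def act_uminus)
  qed (auto simp: ring_of_type_algebra_def annihilator_def act_add)
next
  fix a x assume a: "a \<in> ?J"
  show "x \<otimes>\<^bsub>?R\<^esub> a \<in> ?J"
    using a by (simp add: annihilator_def act_mult[OF lin] ring_of_type_algebra_def)
  have "act T x (act T a f) s = 0" if "s \<in> D" for f s
  proof -
    have zero: "act T a f u = 0" if "u \<in> D" for u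
      using a that by (simp add: annihilator_def)
    have "run T w (act T a f) s = run T w (\<lambda>u. 0) s" for w
      by (rule run_cong[of D T "act T a f" "\<lambda>u. 0" s w, OF restr zero that])
    then have "act T x (act T a f) s = act T x (\<lambda>u. 0) s"
      unfolding act_def[of T x] by (intro sum.cong refl) simp
    then show ?thesis by (simp add: linear_op_zero[OF act_linear[OF lin]])
  qed
  then show "a \<otimes>\<^bsub>?R\<^esub> x \<in> ?J"
    by (simp add: annihilator_def act_mult[OF lin] ring_of_type_algebra_def)
qed

text \<open>
  Operators satisfying the defining relations on a non-empty set \<open>D\<close> make the ideal act by zero on functions on
  \<open>D\<close>, whereas 1 acts as the identity; so 1 is not in the ideal.
\<close>

lemma bilin_algebra_nonzero:
  fixes E :: "'k::field^'m^'m" and F :: "'k^'n^'n"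
    and T :: "'m \<times> 'n \<Rightarrow> ('s \<Rightarrow> 'k) \<Rightarrow> 's \<Rightarrow> 'k"
  assumes lin: "\<And>x. linear_op (T x)"
    and restr: "\<And>x. restrictable D (T x)"
    and "D \<noteq> {}"
    and rel1: "\<And>i j f s. s \<in> D \<Longrightarrow>
      (\<Sum>l\<in>UNIV. \<Sum>k\<in>UNIV. \<Sum>p\<in>UNIV.
        matrix_inv F $ i $ p * E $ k $ l * T (l, j) (T (k, p) f) s) = of_bool (i = j) * f s"
    and rel2: "\<And>i j f s. s \<in> D \<Longrightarrow>
      (\<Sum>k\<in>UNIV. \<Sum>p\<in>UNIV. \<Sum>l\<in>UNIV.
        matrix_inv F $ l $ p * E $ k $ j * T (k, p) (T (i, l) f) s) = of_bool (i = j) * f s"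
  shows "carrier (bilin_algebra E F) \<noteq> {\<zero>\<^bsub>bilin_algebra E F\<^esub>}"
proof
  let ?R = "ring_of_type_algebra :: ('m \<times> 'n, 'k) free_algebra ring"
  let ?I = "bilin_ideal E F"
  interpret R: ring ?R by (rule ring_of_type_algebra_ring)
  have act_mat: "act T (mat 1 $ i $ j) f s = of_bool (i = j) * f s" for i j :: "'x::finite" and f s
    by (simp add: mat_def act_one act_zero)
  have T_scale: "T x (\<lambda>u. a * g u) = (\<lambda>u. a * T x g u)" for x a g
    by (rule ext) (rule linear_op_scale[OF lin])
  have gen: "act T (free_gen x) f = T x f" for x f by (rule ext) (rule act_gen)
  have scalar: "act T (free_scalar a) f = (\<lambda>u. a * f u)" for a f by (rule ext) (rule act_scalar)
  have mult: "act T (p * r) f = act T r (act T p f)" for p r f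
    by (rule ext) (rule act_mult[OF lin])
  have monomial1: "act T (free_scalar a * free_gen x * free_scalar b * free_gen y) f s
      = a * b * T y (T x f) s" for a b x y f s
    by (simp only: mult gen scalar T_scale) (simp add: mult_ac)
  have monomial2: "act T (free_gen x * free_scalar a * free_gen y * free_scalar b) f s
      = a * b * T y (T x f) s" for a b x y f s
    by (simp only: mult gen scalar T_scale) (simp add: mult_ac)
  have "bilin_relations E F \<subseteq> annihilator T D"
  proof
    fix p assume "p \<in> bilin_relations E F"
    then consider
        (left) i j where "p = (scalar_matrix (matrix_inv F) ** transpose gen_matrix ** scalar_matrix E ** gen_matrix - mat 1) $ i $ j"
      | (right) i j where "p = (gen_matrix ** scalar_matrix (matrix_inv F) ** transpose gen_matrix ** scalar_matrix E - mat 1) $ i $ j"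
      unfolding bilin_relations_def Let_def by blast
    then show "p \<in> annihilator T D"
    proof cases
      case left
      then have "p = (\<Sum>l\<in>UNIV. \<Sum>k\<in>UNIV. \<Sum>r\<in>UNIV. free_scalar (matrix_inv F $ i $ r) * free_gen (k, r)
          * free_scalar (E $ k $ l) * free_gen (l, j)) - mat 1 $ i $ j"
        by (simp add: matrix_matrix_mult_def scalar_matrix_def gen_matrix_def transpose_def
            sum_distrib_right)
      then show ?thesis
        by (simp add: annihilator_def act_diff act_sum monomial1 act_mat rel1)
    next
      case right
      then have "p = (\<Sum>k\<in>UNIV. \<Sum>r\<in>UNIV. \<Sum>l\<in>UNIV. free_gen (i, l) * free_scalar (matrix_inv F $ l $ r)
          * free_gen (k, r) * free_scalar (E $ k $ j)) - mat 1 $ i $ j"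
        by (simp add: matrix_matrix_mult_def scalar_matrix_def gen_matrix_def transpose_def
            sum_distrib_right)
      then show ?thesis
        by (simp add: annihilator_def act_diff act_sum monomial2 act_mat rel2)
    qed
  qed
  then have "?I \<subseteq> annihilator T D"
    unfolding bilin_ideal_def
    by (rule R.genideal_minimal[OF annihilator_ideal[OF lin restr]])
  moreover have "1 \<notin> annihilator T D"
  proof
    assume "1 \<in> annihilator T D"
    moreover obtain s where "s \<in> D" using \<open>D \<noteq> {}\<close> by auto
    ultimately have "act T 1 (\<lambda>u. 1) s = 0" unfolding annihilator_def by blast
    then show False by (simp add: act_one)
  qed
  ultimately have "1 \<notin> ?I" by auto
  interpret I: ideal ?I ?R
    unfolding bilin_ideal_def by (rule R.genideal_ideal) (auto simp: ring_of_type_algebra_def)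
  have "1 \<in> ?I +>\<^bsub>?R\<^esub> 1"
    by (rule I.a_rcos_self) (simp add: ring_of_type_algebra_def)
  moreover have "?I +>\<^bsub>?R\<^esub> 1 \<in> carrier (bilin_algebra E F)"
  proof -
    have "carrier (bilin_algebra E F) = a_rcosets\<^bsub>?R\<^esub> ?I"
      by (simp add: bilin_algebra_def ring.defs FactRing_def)
    moreover have "1 \<in> carrier ?R"
      by (simp add: ring_of_type_algebra_def)
    ultimately show ?thesis
      using R.a_rcosetsI[of ?I 1] I.a_subset by simp
  qed
  moreover have "\<zero>\<^bsub>bilin_algebra E F\<^esub> = ?I"
    by (simp add: bilin_algebra_def ring.defs FactRing_def)
  moreover assume "carrier (bilin_algebra E F) = {\<zero>\<^bsub>bilin_algebra E F\<^esub>}"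
  ultimately show False using \<open>1 \<notin> ?I\<close> by auto
qed

section \<open>The representation in a normalized basis\<close>

text \<open>
  A word \<open>x\<^sub>j x\<^sub>k \<dots> v\<^sub>i\<close>: letters stand for the \<open>x\<^sub>j\<close>, and \<open>Vac i\<close> is the vector \<open>v\<^sub>i\<close>.
\<close>

datatype 'n mon = Vac nat | Letter 'n "'n mon"

text \<open>
  The orthogonality \<open>c_orthogonal\<close> makes \<open>yGy = 0\<close> hold on the vectors \<open>v\<^sub>i\<close>. With \<open>row_\<omega>\<close>, the
  normalization \<open>c_\<alpha>\<close> gives the coefficient of \<open>x\<^sub>\<omega> v\<^sub>i\<^sub>+\<^sub>1\<close> in \<open>xGy v\<^sub>i\<close> the value 1, so that
  \<open>xGy = -q\<close> can be solved for this vector.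
\<close>

locale normalized_form =
  fixes F G :: "'n::finite \<Rightarrow> 'n \<Rightarrow> 'k::field"
    and q :: 'k
    and \<alpha> \<omega> :: 'n
    and c :: "nat \<Rightarrow> 'n \<Rightarrow> 'k"
  assumes FG: "\<And>i j. (\<Sum>k\<in>UNIV. F i k * G k j) = of_bool (i = j)"
    and GF: "\<And>i j. (\<Sum>k\<in>UNIV. G i k * F k j) = of_bool (i = j)"
    and row_\<omega>: "\<And>j. G \<omega> j = of_bool (j = \<alpha>)"
    and distinct: "\<alpha> \<noteq> \<omega>"
    and quadratic: "q^2 + (\<Sum>i\<in>UNIV. \<Sum>j\<in>UNIV. G i j * F i j) * q + 1 = 0"
    and c_\<alpha>: "\<And>i. c i \<alpha> = 1"
    and c_orthogonal: "\<And>i. (\<Sum>a\<in>UNIV. \<Sum>b\<in>UNIV. G a b * c i b * c (Suc i) a) = 0"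
begin

definition d :: "nat \<Rightarrow> 'n \<Rightarrow> 'k" where
  "d i a = (\<Sum>b\<in>UNIV. G a b * c i b)"

text \<open>
  The word \<open>x\<^sub>\<omega> m\<close> can be rewritten exactly if \<open>m\<close> is blocked: by \<open>xGx = 0\<close> if \<open>m\<close> starts with
  \<open>x\<^sub>\<alpha>\<close>, and by \<open>xGy = -q\<close> if \<open>m\<close> is \<open>v\<^sub>i\<^sub>+\<^sub>1\<close>. For \<open>v\<^sub>0\<close>, which is no value of a \<open>y\<^sub>j\<close>, there is nothing to rewrite.
  Normal words admit no rewriting anywhere and form the basis of the module.
\<close>

fun blocked :: "'n mon \<Rightarrow> bool" where
  "blocked (Vac i) \<longleftrightarrow> i > 0"
| "blocked (Letter k m) \<longleftrightarrow> k = \<alpha>"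

fun normal :: "'n mon \<Rightarrow> bool" where
  "normal (Vac i) \<longleftrightarrow> True"
| "normal (Letter k m) \<longleftrightarrow> normal m \<and> \<not> (k = \<omega> \<and> blocked m)"

text \<open>
  \<open>opX j f m\<close> is the value of \<open>f\<close> at \<open>x\<^sub>j m\<close>, with \<open>x\<^sub>j m\<close> rewritten to normal words. In the rule
  for \<open>x\<^sub>\<omega> x\<^sub>\<alpha> m = - \<Sum> G\<^sub>a\<^sub>b x\<^sub>a x\<^sub>b m\<close>, the sum being over \<open>a \<noteq> \<omega>\<close>, the left factor \<open>x\<^sub>a\<close> is
  merely prepended, so the recursion only has to rewrite \<open>x\<^sub>b m\<close>.
\<close>

fun opX :: "'n \<Rightarrow> ('n mon \<Rightarrow> 'k) \<Rightarrow> 'n mon \<Rightarrow> 'k" where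
  "opX j f (Vac 0) = f (Letter j (Vac 0))"
| "opX j f (Vac (Suc i)) =
    (if j = \<omega> then - q * f (Vac i) - (\<Sum>a\<in>-{\<omega>}. d i a * f (Letter a (Vac (Suc i))))
     else f (Letter j (Vac (Suc i))))"
| "opX j f (Letter k m) =
    (if j = \<omega> \<and> k = \<alpha> then - (\<Sum>a\<in>-{\<omega>}. \<Sum>b\<in>UNIV. G a b * opX b (\<lambda>u. f (Letter a u)) m)
     else f (Letter j (Letter k m)))"

text \<open>
  \<open>opY j f m\<close> is the value of \<open>f\<close> at \<open>y\<^sub>j m\<close>; the second equation moves \<open>y\<^sub>j\<close> past the first letter
  by \<open>y\<^sub>j x\<^sub>k = q x\<^sub>j y\<^sub>k - q F\<^sub>j\<^sub>k\<close>.
\<close>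

fun opY :: "'n \<Rightarrow> ('n mon \<Rightarrow> 'k) \<Rightarrow> 'n mon \<Rightarrow> 'k" where
  "opY j f (Vac i) = c i j * f (Vac (Suc i))"
| "opY j f (Letter k m) = q * opY k (opX j f) m - q * F j k * f m"

lemma opX_unblocked: "\<not> (j = \<omega> \<and> blocked m) \<Longrightarrow> opX j f m = f (Letter j m)"
  by (induction j f m rule: opX.induct) auto

lemma opX_linear: "linear_op (opX j)"
proof -
  have "opX j (\<lambda>m. a * f m + b * g m) m = a * opX j f m + b * opX j g m" for a b f g m
  proof (induction m arbitrary: j f g)
    case (Vac i)
    show ?case
      by (cases i) (simp_all add: algebra_simps sum.distrib sum_distrib_left)
  next
    case (Letter k m)
    show ?case
      by (simp add: Letter.IH algebra_simps sum.distrib sum_distrib_left)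
  qed
  then show ?thesis by (simp add: linear_op_def)
qed

lemma opY_linear: "linear_op (opY j)"
proof -
  have "opY j (\<lambda>m. a * f m + b * g m) m = a * opY j f m + b * opY j g m" for a b f g m
  proof (induction m arbitrary: j f g)
    case (Vac i)
    show ?case by (simp add: algebra_simps)
  next
    case (Letter k m)
    have "opX j (\<lambda>m. a * f m + b * g m) = (\<lambda>m. a * opX j f m + b * opX j g m)" for f g
      by (rule ext) (rule linear_op_combine[OF opX_linear])
    then show ?case by (simp add: Letter.IH algebra_simps)
  qed
  then show ?thesis by (simp add: linear_op_def)
qed

text \<open>
  Rewriting a product with a normal word yields only normal words, so the values of a function at other words do
  not matter.
\<close>

lemma opX_cong:
  "normal m \<Longrightarrow> (\<And>u. normal u \<Longrightarrow> f u = g u) \<Longrightarrow> opX j f m = opX j g m"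
proof (induction m arbitrary: j f g)
  case (Vac i)
  then show ?case by (cases i) auto
next
  case (Letter k m)
  have "opX b (\<lambda>u. f (Letter a u)) m = opX b (\<lambda>u. g (Letter a u)) m" if "a \<noteq> \<omega>" for a b
    using Letter.prems that by (intro Letter.IH) auto
  then show ?case using Letter.prems by auto
qed

lemma opY_cong:
  "normal m \<Longrightarrow> (\<And>u. normal u \<Longrightarrow> f u = g u) \<Longrightarrow> opY j f m = opY j g m"
proof (induction m arbitrary: j f g)
  case (Vac i)
  then show ?case by simp
next
  case (Letter k m)
  have "opY k (opX j f) m = opY k (opX j g) m"
    using Letter.prems by (intro Letter.IH opX_cong) auto
  then show ?case using Letter.prems by auto
qed

lemma sum_split_\<omega>: "(\<Sum>a\<in>UNIV. h a) = h \<omega> + (\<Sum>a\<in>-{\<omega>}. h a)"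
  for h :: "'n \<Rightarrow> 'k"
  using sum.remove[of UNIV \<omega> h] by (simp add: Compl_eq_Diff_UNIV)

lemma sum_row_\<omega>: "(\<Sum>b\<in>UNIV. G \<omega> b * h b) = h \<alpha>"
  by (simp add: row_\<omega> of_bool_def if_distrib if_distribR cong: if_cong)

text \<open>
  The rule for \<open>x\<^sub>\<omega> x\<^sub>\<alpha>\<close> is this relation solved for its leading term. On the dual,
  the product \<open>x\<^sub>a x\<^sub>b\<close> sends \<open>f\<close> to \<open>opX b (opX a f)\<close>.
\<close>

lemma XGX: "(\<Sum>a\<in>UNIV. \<Sum>b\<in>UNIV. G a b * opX b (opX a f) m) = 0"
proof -
  have "opX a f = (\<lambda>u. f (Letter a u))" if "a \<noteq> \<omega>" for a
    using that by (auto simp: opX_unblocked)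
  then have "(\<Sum>a\<in>-{\<omega>}. \<Sum>b\<in>UNIV. G a b * opX b (opX a f) m)
      = (\<Sum>a\<in>-{\<omega>}. \<Sum>b\<in>UNIV. G a b * opX b (\<lambda>u. f (Letter a u)) m)"
    by (intro sum.cong) auto
  moreover have "opX \<alpha> (opX \<omega> f) m = opX \<omega> f (Letter \<alpha> m)"
    using distinct by (simp add: opX_unblocked)
  ultimately show ?thesis
    by (subst sum_split_\<omega>) (simp add: sum_row_\<omega>)
qed

lemma d_\<omega>: "d i \<omega> = 1"
  by (simp add: d_def sum_row_\<omega> c_\<alpha>)

lemma c_d: "(\<Sum>a\<in>UNIV. d i a * c (Suc i) a) = 0"
  using c_orthogonal[of i] by (simp add: d_def sum_distrib_right)

lemma F_d: "(\<Sum>a\<in>UNIV. F j a * d i a) = c i j"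
proof -
  have "(\<Sum>a\<in>UNIV. F j a * d i a) = (\<Sum>b\<in>UNIV. (\<Sum>a\<in>UNIV. F j a * G a b) * c i b)"
    unfolding d_def sum_distrib_left sum_distrib_right
    by (subst sum.swap) (simp add: mult.assoc)
  then show ?thesis
    by (simp add: FG of_bool_def if_distrib if_distribR cong: if_cong)
qed

lemma sum_GF: "(\<Sum>a\<in>UNIV. \<Sum>b\<in>UNIV. G a b * (F b k * h a)) = h k"
proof -
  have "(\<Sum>a\<in>UNIV. \<Sum>b\<in>UNIV. G a b * (F b k * h a)) = (\<Sum>a\<in>UNIV. (\<Sum>b\<in>UNIV. G a b * F b k) * h a)"
    by (simp add: sum_distrib_right mult.assoc)
  then show ?thesis
    by (simp add: GF of_bool_def if_distrib if_distribR cong: if_cong)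
qed

lemma sum_FG: "(\<Sum>a\<in>UNIV. \<Sum>b\<in>UNIV. G a b * (F k a * h b)) = h k"
proof -
  have "(\<Sum>a\<in>UNIV. \<Sum>b\<in>UNIV. G a b * (F k a * h b)) = (\<Sum>b\<in>UNIV. (\<Sum>a\<in>UNIV. F k a * G a b) * h b)"
    by (subst sum.swap) (simp add: sum_distrib_left sum_distrib_right algebra_simps)
  then show ?thesis
    by (simp add: FG of_bool_def if_distrib if_distribR cong: if_cong)
qed

text \<open>
  On \<open>v\<^sub>i\<close> this is the rule for \<open>x\<^sub>\<omega> v\<^sub>i\<^sub>+\<^sub>1\<close>. On \<open>x\<^sub>k m\<close>, moving \<open>y\<^sub>b\<close> past \<open>x\<^sub>k\<close> leaves
  \<open>q (xGx) y\<^sub>k m - q \<Sum> G\<^sub>a\<^sub>b F\<^sub>b\<^sub>k x\<^sub>a m\<close>, where the first term vanishes and the second is \<open>-q x\<^sub>k m\<close> since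
  \<open>GF = 1\<close>.
\<close>

lemma XGY: "normal m \<Longrightarrow> (\<Sum>a\<in>UNIV. \<Sum>b\<in>UNIV. G a b * opY b (opX a f) m) = - q * f m"
proof (induction m)
  case (Vac i)
  have "(\<Sum>a\<in>UNIV. \<Sum>b\<in>UNIV. G a b * opY b (opX a f) (Vac i)) = (\<Sum>a\<in>UNIV. d i a * opX a f (Vac (Suc i)))"
    by (simp add: d_def sum_distrib_right mult.assoc)
  also have "\<dots> = opX \<omega> f (Vac (Suc i)) + (\<Sum>a\<in>-{\<omega>}. d i a * f (Letter a (Vac (Suc i))))"
    by (subst sum_split_\<omega>) (simp add: d_\<omega> opX_unblocked)
  finally show ?case by simp
next
  case (Letter k m)
  have "(\<Sum>a\<in>UNIV. \<Sum>b\<in>UNIV. G a b * opY b (opX a f) (Letter k m))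
      = q * (\<Sum>a\<in>UNIV. \<Sum>b\<in>UNIV. G a b * opY k (opX b (opX a f)) m)
        - q * (\<Sum>a\<in>UNIV. \<Sum>b\<in>UNIV. G a b * (F b k * opX a f m))"
    by (simp add: algebra_simps sum_subtractf sum_distrib_left)
  also have "(\<Sum>a\<in>UNIV. \<Sum>b\<in>UNIV. G a b * opY k (opX b (opX a f)) m)
      = opY k (\<lambda>u. \<Sum>a\<in>UNIV. \<Sum>b\<in>UNIV. G a b * opX b (opX a f) u) m"
    by (simp add: linear_op_sum[OF opY_linear] linear_op_scale[OF opY_linear])
  also have "\<dots> = 0"
    by (simp add: XGX linear_op_zero[OF opY_linear])
  also have "(\<Sum>a\<in>UNIV. \<Sum>b\<in>UNIV. G a b * (F b k * opX a f m)) = f (Letter k m)"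
    using Letter.prems by (simp add: sum_GF opX_unblocked)
  finally show ?case by simp
qed

text \<open>
  If \<open>x\<^sub>k m\<close> needs no rewriting this is the definition of \<open>y\<^sub>j\<close>; the content is the compatibility
  with the two rewrite rules. For \<open>x\<^sub>\<omega> x\<^sub>\<alpha> m\<close>, moving \<open>y\<^sub>j\<close> through \<open>- \<Sum> G\<^sub>a\<^sub>b x\<^sub>a x\<^sub>b m\<close> (over \<open>a \<noteq> \<omega>\<close>) by
  definition and by induction, and collecting with \<open>xGy = -q\<close> and \<open>FG = 1\<close>, gives the expected value plus
  \<open>q (q\<^sup>2 + tq + 1) x\<^sub>j m\<close>, and the last factor vanishes. For \<open>x\<^sub>\<omega> v\<^sub>i\<^sub>+\<^sub>1\<close> the same
  computation uses \<open>d\<^sub>i \<cdot> c\<^sub>i\<^sub>+\<^sub>1 = 0\<close> and \<open>F d\<^sub>i = c\<^sub>i\<close> for \<open>d\<^sub>i = G c\<^sub>i\<close>.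
\<close>

lemma opY_opX_commute:
  "normal m \<Longrightarrow> opX k (opY j f) m = q * opY k (opX j f) m - q * F j k * f m"
proof (induction m arbitrary: j k f)
  case (Vac i)
  show ?case
  proof (cases "k = \<omega> \<and> i > 0")
    case False
    then show ?thesis by (subst opX_unblocked) auto
  next
    case True
    then obtain l where i: "i = Suc l" and k: "k = \<omega>" by (cases i) auto
    let ?g = "opX j f (Vac (Suc (Suc l)))"
    have "opX \<omega> (opY j f) (Vac (Suc l)) = - q * (c l j * f (Vac (Suc l)))
        - q * (\<Sum>a\<in>-{\<omega>}. d l a * c (Suc l) a) * ?g + q * (\<Sum>a\<in>-{\<omega>}. F j a * d l a) * f (Vac (Suc l))"
      by (simp add: algebra_simps sum_subtractf sum_distrib_left sum_distrib_right)
    also have "(\<Sum>a\<in>-{\<omega>}. d l a * c (Suc l) a) = - c (Suc l) \<omega>"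
      using c_d[of l] unfolding sum_split_\<omega>[of "\<lambda>a. d l a * c (Suc l) a"] d_\<omega>
      by (simp add: eq_neg_iff_add_eq_0 add.commute)
    also have "(\<Sum>a\<in>-{\<omega>}. F j a * d l a) = c l j - F j \<omega>"
      using F_d[of j l] unfolding sum_split_\<omega>[of "\<lambda>a. F j a * d l a"] d_\<omega>
      by (simp add: eq_diff_eq add.commute)
    finally show ?thesis by (simp add: i k algebra_simps)
  qed
next
  case (Letter l m)
  show ?case
  proof (cases "k = \<omega> \<and> l = \<alpha>")
    case False
    then show ?thesis by (subst opX_unblocked) auto
  next
    case True
    have m: "normal m" using Letter.prems by simp
    let ?g = "opX j f"
    let ?t = "\<Sum>i\<in>UNIV. \<Sum>j\<in>UNIV. G i j * F i j"
    \<comment> \<open>\<open>y\<^sub>j x\<^sub>a x\<^sub>b m\<close> for \<open>a \<noteq> \<omega>\<close>: past \<open>x\<^sub>a\<close> by definition, past \<open>x\<^sub>b\<close> by induction.\<close>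
    have inner: "opX b (\<lambda>u. opY j f (Letter a u)) m
        = q * (q * opY b (opX a ?g) m) - q * (q * (F a b * ?g m)) - q * (F j a * opX b f m)" for a b
    proof -
      have "opX b (\<lambda>u. opY j f (Letter a u)) m = opX b (\<lambda>u. q * opY a ?g u - (q * F j a) * f u) m"
        by simp
      also have "\<dots> = q * opX b (opY a ?g) m - q * F j a * opX b f m"
        by (simp only: linear_op_diff[OF opX_linear] linear_op_scale[OF opX_linear])
      finally show ?thesis by (simp add: Letter.IH[OF m] algebra_simps)
    qed
    let ?S = "\<lambda>h. \<Sum>a\<in>-{\<omega>}. \<Sum>b\<in>UNIV. G a b * h a b"
    \<comment> \<open>Row \<open>\<omega>\<close> of \<open>G\<close> has the single entry 1 in column \<open>\<alpha>\<close>, so a sum over \<open>a \<noteq> \<omega>\<close> is the full sum less one term.\<close>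
    have S: "?S h = (\<Sum>a\<in>UNIV. \<Sum>b\<in>UNIV. G a b * h a b) - h \<omega> \<alpha>" for h :: "'n \<Rightarrow> 'n \<Rightarrow> 'k"
      by (simp add: sum_split_\<omega>[of "\<lambda>a. \<Sum>b\<in>UNIV. G a b * h a b"] sum_row_\<omega>)
    have "opX \<omega> (opY j f) (Letter \<alpha> m) = - ?S (\<lambda>a b. opX b (\<lambda>u. opY j f (Letter a u)) m)"
      by (simp del: opY.simps)
    also have "\<dots> = - (q * q * ?S (\<lambda>a b. opY b (opX a ?g) m)) + q * q * (?S F * ?g m)
        + q * ?S (\<lambda>a b. F j a * opX b f m)"
      unfolding inner by (simp add: algebra_simps sum_subtractf sum.distrib sum_distrib_left sum_distrib_right sum_negf)
    also have "?S (\<lambda>a b. opY b (opX a ?g) m) = - q * ?g m - opY \<alpha> (opX \<omega> ?g) m"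
      by (simp add: S XGY[OF m])
    also have "?S F = ?t - F \<omega> \<alpha>"
      by (rule S)
    also have "?S (\<lambda>a b. F j a * opX b f m) = ?g m - F j \<omega> * f (Letter \<alpha> m)"
      using distinct by (simp add: S sum_FG opX_unblocked)
    also have "- (q * q * (- q * ?g m - opY \<alpha> (opX \<omega> ?g) m)) + q * q * ((?t - F \<omega> \<alpha>) * ?g m)
        + q * (?g m - F j \<omega> * f (Letter \<alpha> m))
      = q * (q^2 + ?t * q + 1) * ?g m
        + q * (q * opY \<alpha> (opX \<omega> ?g) m - q * F \<omega> \<alpha> * ?g m) - q * F j \<omega> * f (Letter \<alpha> m)"
      by (simp add: algebra_simps power2_eq_square)
    finally show ?thesis
      using True by (simp add: quadratic)
  qed
qed

text \<open>
  Exchanging \<open>y\<^sub>a\<close> and \<open>x\<^sub>b\<close> turns \<open>yGx\<close> into \<open>q xGy - q t = -q\<^sup>2 - q t = 1\<close>.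
\<close>

lemma YGX:
  assumes "normal m"
  shows "(\<Sum>a\<in>UNIV. \<Sum>b\<in>UNIV. G a b * opX b (opY a f) m) = f m"
proof -
  let ?t = "\<Sum>i\<in>UNIV. \<Sum>j\<in>UNIV. G i j * F i j"
  have "(\<Sum>a\<in>UNIV. \<Sum>b\<in>UNIV. G a b * opX b (opY a f) m)
      = q * (\<Sum>a\<in>UNIV. \<Sum>b\<in>UNIV. G a b * opY b (opX a f) m) - q * (?t * f m)"
    by (simp add: opY_opX_commute[OF assms] algebra_simps sum_subtractf sum_distrib_left)
  also have "\<dots> = f m - (q^2 + ?t * q + 1) * f m"
    by (simp add: XGY[OF assms] algebra_simps power2_eq_square)
  finally show ?thesis by (simp add: quadratic)
qed

text \<open>
  On \<open>v\<^sub>i\<close> this is the orthogonality of \<open>c\<^sub>i\<^sub>+\<^sub>1\<close> and \<open>c\<^sub>i\<close>. On \<open>x\<^sub>k u\<close>, moving \<open>y\<^sub>b\<close> past \<open>x\<^sub>k\<close> gives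
  \<open>q (yGx) y\<^sub>k u - q y\<^sub>k u\<close>, which vanishes because \<open>yGx = 1\<close>.
\<close>

lemma YGY: "normal m \<Longrightarrow> (\<Sum>a\<in>UNIV. \<Sum>b\<in>UNIV. G a b * opY b (opY a f) m) = 0"
proof (cases m)
  case (Vac i)
  have "(\<Sum>a\<in>UNIV. \<Sum>b\<in>UNIV. G a b * opY b (opY a f) (Vac i))
      = (\<Sum>a\<in>UNIV. \<Sum>b\<in>UNIV. G a b * c i b * c (Suc i) a) * f (Vac (Suc (Suc i)))"
    by (simp add: sum_distrib_right mult.assoc)
  then show ?thesis by (simp add: c_orthogonal Vac)
next
  case (Letter k u)
  assume "normal m"
  then have u: "normal u" using Letter by simp
  have "(\<Sum>a\<in>UNIV. \<Sum>b\<in>UNIV. G a b * opY b (opY a f) (Letter k u))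
      = q * (\<Sum>a\<in>UNIV. \<Sum>b\<in>UNIV. G a b * opY k (opX b (opY a f)) u)
        - q * (\<Sum>a\<in>UNIV. \<Sum>b\<in>UNIV. G a b * (F b k * opY a f u))"
    by (simp add: algebra_simps sum_subtractf sum_distrib_left)
  also have "(\<Sum>a\<in>UNIV. \<Sum>b\<in>UNIV. G a b * opY k (opX b (opY a f)) u)
      = opY k (\<lambda>v. \<Sum>a\<in>UNIV. \<Sum>b\<in>UNIV. G a b * opX b (opY a f) v) u"
    by (simp add: linear_op_sum[OF opY_linear] linear_op_scale[OF opY_linear])
  also have "\<dots> = opY k f u"
    by (rule opY_cong[OF u]) (simp add: YGX)
  finally show ?thesis by (simp add: sum_GF Letter)
qed

end

section \<open>Choice of the basis and of the coefficients\<close>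

lemma sum_delta:
  fixes h :: "'n::finite \<Rightarrow> 'k::comm_ring_1"
  shows "(\<Sum>j\<in>UNIV. of_bool (j = i) * h j) = h i" "(\<Sum>j\<in>UNIV. of_bool (i = j) * h j) = h i"
    "(\<Sum>j\<in>UNIV. h j * of_bool (j = i)) = h i" "(\<Sum>j\<in>UNIV. h j * of_bool (i = j)) = h i"
  by simp_all

text \<open>
  On a plane spanned by two coordinate vectors \<open>e\<^sub>p, e\<^sub>r\<close> either \<open>e\<^sub>p\<close> is isotropic or the value of the form at
  \<open>e\<^sub>r + t e\<^sub>p\<close> is a quadratic polynomial in \<open>t\<close>, which has a root.
\<close>

lemma isotropic_vector:
  fixes G :: "'k::alg_closed_field^'n^'n"
  assumes "CARD('n) \<ge> 2"
  shows "\<exists>u. u \<noteq> 0 \<and> (\<Sum>i\<in>UNIV. \<Sum>j\<in>UNIV. u $ i * G $ i $ j * u $ j) = 0"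
proof -
  have "\<exists>p r :: 'n. p \<noteq> r"
  proof (rule ccontr)
    assume "\<not> ?thesis"
    then have "card (UNIV :: 'n set) \<le> Suc 0"
      by (simp add: card_le_Suc0_iff_eq)
    then show False using assms by simp
  qed
  then obtain p r :: 'n where "p \<noteq> r" by (elim exE)
  show ?thesis
  proof (cases "G $ p $ p = 0")
    case True
    have "(\<Sum>i\<in>UNIV. \<Sum>j\<in>UNIV. of_bool (i = p) * G $ i $ j * of_bool (j = p)) = G $ p $ p"
      by (simp add: sum_delta)
    then show ?thesis
      using True by (intro exI[of _ "\<chi> i. of_bool (i = p)"]) (auto simp: vec_eq_iff)
  next
    case False
    define f where "f k = (if k = 0 then G $ r $ r else if k = 1 then G $ r $ p + G $ p $ r else G $ p $ p)" for k :: nat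
    obtain t where t: "(\<Sum>k\<le>2. f k * t ^ k) = 0"
      using alg_closed[of 2 f] False by (auto simp: f_def)
    let ?u = "\<lambda>i. of_bool (i = r) + t * of_bool (i = p)"
    have sum_u: "(\<Sum>j\<in>UNIV. h j * ?u j) = h r + t * h p" for h
      by (simp add: distrib_left sum.distrib mult.commute[of t] flip: mult.assoc sum_distrib_right)
    have "(\<Sum>i\<in>UNIV. \<Sum>j\<in>UNIV. ?u i * G $ i $ j * ?u j)
        = (\<Sum>i\<in>UNIV. (G $ i $ r + t * G $ i $ p) * ?u i)"
      by (intro sum.cong refl) (subst sum_u, simp add: algebra_simps)
    also have "\<dots> = G $ r $ r + t * G $ r $ p + t * (G $ p $ r + t * G $ p $ p)"
      by (rule sum_u)
    also have "\<dots> = 0"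
      using t by (simp add: f_def numeral_2_eq_2 algebra_simps)
    finally show ?thesis
      using \<open>p \<noteq> r\<close> by (intro exI[of _ "\<chi> i. ?u i"]) (auto simp: vec_eq_iff intro!: exI[of _ r])
  qed
qed

lemma bilinear_entry:
  fixes R G :: "'k::comm_ring_1^'n^'n"
  shows "(R ** G ** transpose R) $ i $ j = (\<Sum>a\<in>UNIV. \<Sum>b\<in>UNIV. R $ i $ a * G $ a $ b * R $ j $ b)"
  unfolding matrix_matrix_mult_def transpose_def
  by (simp add: sum_distrib_right) (rule sum.swap)

text \<open>
  The rows of \<open>R\<close> are the new basis. The vector \<open>\<omega>\<close> is isotropic, so the functional \<open>G(e\<^sub>\<omega>, _)\<close>
  vanishes on \<open>e\<^sub>\<omega>\<close> itself; it is non-zero on some other basis vector, which becomes \<open>e\<^sub>\<alpha>\<close> after scaling and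
  which is used to bring all remaining basis vectors into the kernel of the functional.
\<close>

lemma normalizing_basis:
  fixes G :: "'k::alg_closed_field^'n^'n"
  assumes "CARD('n) \<ge> 2" and "invertible G"
  obtains R :: "'k^'n^'n" and \<alpha> \<omega>
  where "invertible R" "\<alpha> \<noteq> \<omega>" "\<forall>j. (R ** G ** transpose R) $ \<omega> $ j = of_bool (j = \<alpha>)"
proof -
  obtain u where u: "u \<noteq> 0 \<and> (\<Sum>i\<in>UNIV. \<Sum>j\<in>UNIV. u $ i * G $ i $ j * u $ j) = 0"
    using isotropic_vector[OF assms(1), of G] by (rule exE)
  then obtain \<omega> where \<omega>: "u $ \<omega> \<noteq> 0" by (auto simp: vec_eq_iff)
  \<comment> \<open>\<open>R1\<close> replaces the basis vector \<open>e\<^sub>\<omega>\<close> by \<open>u\<close>; \<open>R2\<close> then clears row \<open>\<omega>\<close> of the form.\<close>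
  define R1 :: "'k^'n^'n" where "R1 = (\<chi> i j. if i = \<omega> then u $ j else of_bool (i = j))"
  have "x = 0" if "R1 *v x = 0" for x
  proof -
    have "x $ i = 0" if "i \<noteq> \<omega>" for i
    proof -
      have "(R1 *v x) $ i = x $ i"
        using that by (simp add: R1_def matrix_vector_mult_def sum_delta)
      then show ?thesis using \<open>R1 *v x = 0\<close> by simp
    qed
    moreover from this have "(R1 *v x) $ \<omega> = u $ \<omega> * x $ \<omega>"
      by (simp add: R1_def matrix_vector_mult_def sum.remove[of UNIV \<omega>])
    ultimately show ?thesis
      using \<open>R1 *v x = 0\<close> \<omega> by (simp add: vec_eq_iff) metis
  qed
  then have "invertible R1"
    by (simp add: invertible_left_inverse matrix_left_invertible_ker)
  define H where "H = R1 ** G ** transpose R1"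
  have "invertible (transpose R1)"
    using \<open>invertible R1\<close> by (metis invertible_def matrix_transpose_mul transpose_mat)
  then have "invertible H"
    unfolding H_def using \<open>invertible R1\<close> assms(2) by (intro invertible_mult)
  have "H $ \<omega> $ \<omega> = 0"
    using u by (simp add: H_def bilinear_entry R1_def)
  obtain \<alpha> where \<alpha>: "H $ \<omega> $ \<alpha> \<noteq> 0"
  proof (rule ccontr)
    assume "\<not> thesis"
    then have "\<And>j. H $ \<omega> $ j = 0" using that by blast
    then have "(H ** B) $ \<omega> $ \<omega> = 0" for B :: "'k^'n^'n"
      by (simp add: matrix_matrix_mult_def)
    moreover obtain B where "H ** B = mat 1"
      using \<open>invertible H\<close> unfolding invertible_def by (elim exE conjE)
    ultimately have "(mat 1 :: 'k^'n^'n) $ \<omega> $ \<omega> = 0"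
      by metis
    then show False by (simp add: mat_def)
  qed
  then have "\<alpha> \<noteq> \<omega>" using \<open>H $ \<omega> $ \<omega> = 0\<close> by auto
  define h where "h = H $ \<omega> $ \<alpha>"
  have "h \<noteq> 0" using \<alpha> by (simp add: h_def)
  define R2 :: "'k^'n^'n" where
    "R2 = (\<chi> i j. if j = \<alpha> then (if i = \<alpha> then 1 / h else - (H $ \<omega> $ i / h)) else of_bool (i = j))"
  have R2_sum: "(\<Sum>j\<in>UNIV. R2 $ i $ j * x j) = (if i = \<alpha> then x \<alpha> / h else x i - H $ \<omega> $ i / h * x \<alpha>)"
    for i and x :: "'n \<Rightarrow> 'k"
  proof -
    have "(\<Sum>j\<in>UNIV. R2 $ i $ j * x j) = R2 $ i $ \<alpha> * x \<alpha> + (\<Sum>j\<in>-{\<alpha>}. of_bool (i = j) * x j)"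
      by (simp add: sum.remove[of UNIV \<alpha>] R2_def Compl_eq_Diff_UNIV)
    also have "(\<Sum>j\<in>-{\<alpha>}. of_bool (i = j) * x j) = (if i = \<alpha> then 0 else x i)"
      by (cases "i = \<alpha>") (auto simp: of_bool_def if_distrib[where f = "\<lambda>x. x * _"] cong: if_cong)
    finally show ?thesis by (simp add: R2_def)
  qed
  have "x = 0" if "R2 *v x = 0" for x
  proof -
    have R2x: "(if i = \<alpha> then x $ \<alpha> / h else x $ i - H $ \<omega> $ i / h * x $ \<alpha>) = 0" for i
      using that R2_sum[of i "\<lambda>j. x $ j"] by (simp add: matrix_vector_mult_def vec_eq_iff)
    have "x $ \<alpha> = 0" using R2x[of \<alpha>] \<open>h \<noteq> 0\<close> by simp
    then have "x $ i = 0" for i using R2x[of i] by (simp split: if_splits)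
    then show ?thesis by (simp add: vec_eq_iff)
  qed
  then have "invertible R2"
    by (simp add: invertible_left_inverse matrix_left_invertible_ker)
  have "(R2 ** R1 ** G ** transpose (R2 ** R1)) = R2 ** H ** transpose R2"
    by (simp add: H_def matrix_transpose_mul matrix_mul_assoc)
  moreover have "(R2 ** H ** transpose R2) $ \<omega> $ j = of_bool (j = \<alpha>)" for j
  proof -
    have "(R2 ** H ** transpose R2) $ \<omega> $ j = (\<Sum>a\<in>UNIV. R2 $ \<omega> $ a * (\<Sum>b\<in>UNIV. R2 $ j $ b * H $ a $ b))"
      by (simp add: bilinear_entry sum_distrib_left mult_ac)
    also have "\<dots> = (\<Sum>b\<in>UNIV. R2 $ j $ b * H $ \<omega> $ b)"
      using \<open>\<alpha> \<noteq> \<omega>\<close> \<open>H $ \<omega> $ \<omega> = 0\<close> by (simp add: R2_sum[of \<omega>])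
    also have "\<dots> = of_bool (j = \<alpha>)"
      using \<open>h \<noteq> 0\<close> by (simp add: R2_sum flip: h_def)
    finally show ?thesis .
  qed
  ultimately show thesis
    using that[of "R2 ** R1" \<alpha> \<omega>] \<open>\<alpha> \<noteq> \<omega>\<close> \<open>invertible R1\<close> \<open>invertible R2\<close>
    by (simp add: invertible_mult)
qed

text \<open>
  Two coordinates suffice: for \<open>c\<^sub>i = e\<^sub>\<alpha> + s\<^sub>i e\<^sub>\<omega>\<close>, the coordinate \<open>\<omega>\<close> of \<open>G c\<^sub>i\<close> is 1 by the shape of
  row \<open>\<omega>\<close>, so orthogonality is a linear equation for \<open>s\<^sub>i\<^sub>+\<^sub>1\<close> with leading coefficient 1.
\<close>

lemma orthogonal_sequence:
  fixes G :: "'n::finite \<Rightarrow> 'n \<Rightarrow> 'k::comm_ring_1"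
  assumes row: "\<And>j. G \<omega> j = of_bool (j = \<alpha>)" and "\<alpha> \<noteq> \<omega>"
  shows "\<exists>c. \<forall>i. c i \<alpha> = 1 \<and> (\<Sum>a\<in>UNIV. \<Sum>b\<in>UNIV. G a b * c i b * c (Suc i) a) = 0"
proof -
  define s where "s = rec_nat (0 :: 'k) (\<lambda>_ x. - (G \<alpha> \<alpha> + G \<alpha> \<omega> * x))"
  define c where "c i a = of_bool (a = \<alpha>) + s i * of_bool (a = \<omega>)" for i a
  have sum_c: "(\<Sum>b\<in>UNIV. h b * c i b) = h \<alpha> + h \<omega> * s i" for h i
    by (simp add: c_def distrib_left sum.distrib sum_delta flip: mult.assoc)
  have "(\<Sum>a\<in>UNIV. \<Sum>b\<in>UNIV. G a b * c i b * c (Suc i) a) = 0" for i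
  proof -
    have "(\<Sum>a\<in>UNIV. \<Sum>b\<in>UNIV. G a b * c i b * c (Suc i) a)
        = (\<Sum>a\<in>UNIV. (G a \<alpha> + G a \<omega> * s i) * c (Suc i) a)"
      by (simp add: sum_c flip: sum_distrib_right)
    also have "\<dots> = G \<alpha> \<alpha> + G \<alpha> \<omega> * s i + s (Suc i)"
      using \<open>\<alpha> \<noteq> \<omega>\<close> by (simp only: sum_c) (simp add: row)
    also have "\<dots> = 0" by (simp add: s_def)
    finally show ?thesis .
  qed
  moreover have "c i \<alpha> = 1" for i using \<open>\<alpha> \<noteq> \<omega>\<close> by (simp add: c_def)
  ultimately show ?thesis by (intro exI[of _ c]) simp
qed

section \<open>Inverse matrices and base change\<close>

lemma matrix_inv_inverse:
  assumes "invertible A"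
  shows "A ** matrix_inv A = mat 1" "matrix_inv A ** A = mat 1"
  using someI_ex[OF assms[unfolded invertible_def]] by (simp_all add: matrix_inv_def)

lemma matrix_inv_unique:
  assumes "A ** B = mat 1" "B ** A = mat 1"
  shows "matrix_inv A = B"
proof -
  have "invertible A" using assms by (auto simp: invertible_def)
  then have "matrix_inv A = matrix_inv A ** (A ** B)" "matrix_inv A ** A = mat 1"
    by (simp_all add: assms matrix_inv_inverse)
  then show ?thesis by (simp add: matrix_mul_assoc)
qed

lemma trace_times_transpose:
  "trace (A ** transpose B) = (\<Sum>i\<in>UNIV. \<Sum>j\<in>UNIV. A $ i $ j * B $ i $ j)"
  by (simp add: trace_def matrix_matrix_mult_def transpose_def)

text \<open>
  The matrix \<open>z R\<close>, for a matrix \<open>z\<close> of operators.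
\<close>

definition base_change :: "'k::field^'n^'n \<Rightarrow> ('m \<Rightarrow> 'n::finite \<Rightarrow> ('s \<Rightarrow> 'k) \<Rightarrow> 's \<Rightarrow> 'k) \<Rightarrow>
    'm \<times> 'n \<Rightarrow> ('s \<Rightarrow> 'k) \<Rightarrow> 's \<Rightarrow> 'k" where
  "base_change R Z x f s = (\<Sum>l\<in>UNIV. R $ l $ snd x * Z (fst x) l f s)"

lemma base_change_linear:
  assumes "\<And>i l. linear_op (Z i l)"
  shows "linear_op (base_change R Z x)"
  unfolding linear_op_def base_change_def
  by (simp add: linear_op_combine[OF assms] algebra_simps sum.distrib sum_distrib_left)

lemma base_change_restrictable:
  fixes R :: "'k::field^'n^'n" and Z :: "'m \<Rightarrow> 'n \<Rightarrow> ('s \<Rightarrow> 'k) \<Rightarrow> 's \<Rightarrow> 'k"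
  assumes "\<And>i l. restrictable D (Z i l)"
  shows "restrictable D (base_change R Z x)"
  unfolding restrictable_def base_change_def
proof (intro allI impI ballI)
  fix f g :: "'s \<Rightarrow> 'k" and s
  assume fg: "\<forall>u\<in>D. f u = g u" and "s \<in> D"
  have "Z i l f s = Z i l g s" for i l
    by (rule restrictableD[OF assms _ \<open>s \<in> D\<close>]) (rule bspec[OF fg])
  then show "(\<Sum>l\<in>UNIV. R $ l $ snd x * Z (fst x) l f s) = (\<Sum>l\<in>UNIV. R $ l $ snd x * Z (fst x) l g s)"
    by simp
qed

lemma base_change_product:
  assumes "\<And>i l. linear_op (Z i l)"
  shows "base_change R Z (i, j) (base_change R Z (k, p) f) s
    = (\<Sum>a\<in>UNIV. \<Sum>b\<in>UNIV. R $ a $ p * R $ b $ j * Z i b (Z k a f) s)"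
proof -
  have "base_change R Z (k, p) f = (\<lambda>u. \<Sum>a\<in>UNIV. R $ a $ p * Z k a f u)"
    by (rule ext) (simp add: base_change_def)
  then have "base_change R Z (i, j) (base_change R Z (k, p) f) s
      = (\<Sum>b\<in>UNIV. R $ b $ j * (\<Sum>a\<in>UNIV. R $ a $ p * Z i b (Z k a f) s))"
    by (simp add: base_change_def linear_op_sum[OF assms] linear_op_scale[OF assms])
  also have "\<dots> = (\<Sum>b\<in>UNIV. \<Sum>a\<in>UNIV. R $ a $ p * R $ b $ j * Z i b (Z k a f) s)"
    by (simp add: sum_distrib_left mult_ac)
  finally show ?thesis by (subst sum.swap) simp
qed

text \<open>
  If \<open>z = z' R\<close>, then \<open>z G \<^sup>tz = z' (R G \<^sup>tR) \<^sup>tz'\<close>, entry by entry.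
\<close>

lemma base_change_contract:
  assumes "\<And>i l. linear_op (Z i l)"
  shows "(\<Sum>p\<in>UNIV. \<Sum>l\<in>UNIV. G $ l $ p * base_change R Z (k, p) (base_change R Z (i, l) f) s)
    = (\<Sum>a\<in>UNIV. \<Sum>b\<in>UNIV. (R ** G ** transpose R) $ a $ b * Z k b (Z i a f) s)"
proof -
  have "(\<Sum>p\<in>UNIV. \<Sum>l\<in>UNIV. G $ l $ p * base_change R Z (k, p) (base_change R Z (i, l) f) s)
      = (\<Sum>p\<in>UNIV. \<Sum>l\<in>UNIV. \<Sum>a\<in>UNIV. \<Sum>b\<in>UNIV. R $ a $ l * G $ l $ p * R $ b $ p * Z k b (Z i a f) s)"
    by (simp add: base_change_product[OF assms] sum_distrib_left mult_ac)
  also have "\<dots> = (\<Sum>p\<in>UNIV. \<Sum>a\<in>UNIV. \<Sum>b\<in>UNIV. \<Sum>l\<in>UNIV. R $ a $ l * G $ l $ p * R $ b $ p * Z k b (Z i a f) s)"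
    by (subst (2) sum.swap) (subst (3) sum.swap, rule refl)
  also have "\<dots> = (\<Sum>a\<in>UNIV. \<Sum>b\<in>UNIV. \<Sum>l\<in>UNIV. \<Sum>p\<in>UNIV. R $ a $ l * G $ l $ p * R $ b $ p * Z k b (Z i a f) s)"
    by (subst sum.swap) (subst (2) sum.swap, subst (3) sum.swap, rule refl)
  also have "\<dots> = (\<Sum>a\<in>UNIV. \<Sum>b\<in>UNIV. (R ** G ** transpose R) $ a $ b * Z k b (Z i a f) s)"
    by (simp add: bilinear_entry sum_distrib_right)
  finally show ?thesis .
qed

section \<open>Non-vanishing\<close>

lemma E_mat_entries:
  "E_mat q $ 1 $ 1 = 0" "E_mat q $ 1 $ 2 = 1" "E_mat q $ 2 $ 1 = - inverse q" "E_mat q $ 2 $ 2 = 0"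
  by (simp_all add: E_mat_def)

theorem proposition3p4:
  fixes q :: "'k::alg_closed_field" and F :: "'k^'n^'n"
  assumes "q \<noteq> 0"
    and "invertible F"
    and "CARD('n) \<ge> 2"
    and "q^2 + trace (F ** matrix_inv (Finite_Cartesian_Product.transpose F)) * q + 1 = 0"
  shows "carrier (bilin_algebra (E_mat q) F) \<noteq> {\<zero>\<^bsub>bilin_algebra (E_mat q) F\<^esub>}"
proof -
  define G where "G = matrix_inv F"
  have F_G: "F ** G = mat 1" and G_F: "G ** F = mat 1"
    using matrix_inv_inverse[OF assms(2)] by (simp_all add: G_def)
  then have "invertible G" by (auto simp: invertible_def)
  obtain R :: "'k^'n^'n" and \<alpha> \<omega> where R: "invertible R" and "\<alpha> \<noteq> \<omega>"
    and row: "\<forall>j. (R ** G ** transpose R) $ \<omega> $ j = of_bool (j = \<alpha>)"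
    by (rule normalizing_basis[OF assms(3) \<open>invertible G\<close>])
  \<comment> \<open>In the new basis the two forms are \<open>G'\<close> and its inverse \<open>F'\<close>; the trace in the hypothesis is unchanged.\<close>
  define S where "S = matrix_inv R"
  have RS: "R ** S = mat 1" and SR: "S ** R = mat 1"
    using matrix_inv_inverse[OF R] by (simp_all add: S_def)
  have RSt: "transpose S ** transpose R = mat 1" and SRt: "transpose R ** transpose S = mat 1"
    using RS SR by (simp_all add: transpose_mat flip: matrix_transpose_mul)
  define G' where "G' = R ** G ** transpose R"
  define F' where "F' = transpose S ** F ** S"
  have "F' ** G' = transpose S ** F ** (S ** R) ** G ** transpose R"
    by (simp add: F'_def G'_def matrix_mul_assoc)
  also have "\<dots> = transpose S ** (F ** G) ** transpose R"
    by (simp add: SR matrix_mul_assoc)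
  finally have F'G': "F' ** G' = mat 1" by (simp add: F_G RSt)
  then have G'F': "G' ** F' = mat 1" by (simp add: matrix_left_right_inverse)
  have F_R: "transpose R ** F' ** R = F"
  proof -
    have "transpose R ** F' ** R = (transpose R ** transpose S) ** F ** (S ** R)"
      by (simp add: F'_def matrix_mul_assoc)
    then show ?thesis by (simp add: SR SRt)
  qed
  have trace: "trace (F ** matrix_inv (transpose F)) = (\<Sum>i\<in>UNIV. \<Sum>j\<in>UNIV. G' $ i $ j * F' $ i $ j)"
  proof -
    have "matrix_inv (transpose F) = transpose G"
      by (rule matrix_inv_unique) (simp_all add: F_G G_F transpose_mat flip: matrix_transpose_mul)
    then have "trace (F ** matrix_inv (transpose F)) = trace (G ** transpose F)"
      by (simp add: trace_times_transpose mult.commute)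
    also have "\<dots> = trace (S ** (R ** (G ** transpose F)))"
      by (simp add: SR matrix_mul_assoc)
    also have "\<dots> = trace (R ** (G ** transpose F) ** S)"
      by (rule trace_mul_sym)
    also have "R ** (G ** transpose F) ** S = R ** G ** (transpose R ** transpose S) ** transpose F ** S"
      by (simp add: SRt matrix_mul_assoc)
    also have "\<dots> = G' ** transpose F'"
      by (simp add: G'_def F'_def matrix_transpose_mul matrix_mul_assoc)
    finally show ?thesis by (simp add: trace_times_transpose)
  qed
  obtain c :: "nat \<Rightarrow> 'n \<Rightarrow> 'k" where c: "\<forall>i. c i \<alpha> = 1 \<and>
      (\<Sum>a\<in>UNIV. \<Sum>b\<in>UNIV. G' $ a $ b * c i b * c (Suc i) a) = 0"
    using orthogonal_sequence[of "\<lambda>a b. G' $ a $ b" \<omega> \<alpha>, OF row[folded G'_def, rule_format] \<open>\<alpha> \<noteq> \<omega>\<close>] by (rule exE)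
  interpret normalized_form "\<lambda>i j. F' $ i $ j" "\<lambda>i j. G' $ i $ j" q \<alpha> \<omega> c
  proof
    have "(F' ** G') $ i $ j = of_bool (i = j)" "(G' ** F') $ i $ j = of_bool (i = j)" for i j
      by (simp_all add: F'G' G'F' mat_def)
    then show "(\<Sum>k\<in>UNIV. F' $ i $ k * G' $ k $ j) = of_bool (i = j)"
      "(\<Sum>k\<in>UNIV. G' $ i $ k * F' $ k $ j) = of_bool (i = j)" for i j
      by (simp_all add: matrix_matrix_mult_def)
    show "G' $ \<omega> $ j = of_bool (j = \<alpha>)" for j
      unfolding G'_def using row by (rule spec)
    show "q\<^sup>2 + (\<Sum>i\<in>UNIV. \<Sum>j\<in>UNIV. G' $ i $ j * F' $ i $ j) * q + 1 = 0"
      using assms(4) by (simp add: trace)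
  qed (use c \<open>\<alpha> \<noteq> \<omega>\<close> in simp_all)
  define Z :: "2 \<Rightarrow> 'n \<Rightarrow> ('n mon \<Rightarrow> 'k) \<Rightarrow> 'n mon \<Rightarrow> 'k" where
    "Z i = (if i = 1 then opX else opY)" for i
  have Z: "Z 1 = opX" "Z 2 = opY" by (simp_all add: Z_def)
  have lin: "linear_op (Z i l)" for i l by (simp add: Z_def opX_linear opY_linear)
  have restr: "restrictable {m. normal m} (Z i l)" for i l
    unfolding restrictable_def Z_def by (auto intro: opX_cong opY_cong)
  let ?T = "base_change R Z"
  show ?thesis
  proof (rule bilin_algebra_nonzero)
    show "linear_op (?T x)" for x by (rule base_change_linear[OF lin])
    show "restrictable {m. normal m} (?T x)" for x by (rule base_change_restrictable[OF restr])
    show "{m :: 'n mon. normal m} \<noteq> {}"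
      using normal.simps(1) by blast
  next
    fix i j :: 'n and f s assume s: "s \<in> {m. normal m}"
    have "?T (2, j) (?T (1, p) f) s - inverse q * ?T (1, j) (?T (2, p) f) s = F $ p $ j * f s" for p
    proof -
      have "?T (2, j) (?T (1, p) f) s - inverse q * ?T (1, j) (?T (2, p) f) s
        = (\<Sum>a\<in>UNIV. \<Sum>b\<in>UNIV. R $ a $ p * R $ b $ j *
            (opY b (opX a f) s - inverse q * opX b (opY a f) s))"
        unfolding base_change_product[OF lin] Z
        by (simp add: sum_distrib_left sum_subtractf algebra_simps)
      also have "\<dots> = (\<Sum>a\<in>UNIV. \<Sum>b\<in>UNIV. R $ a $ p * R $ b $ j * (F' $ a $ b * f s))"
        using s \<open>q \<noteq> 0\<close> by (simp add: opY_opX_commute right_diff_distrib flip: mult.assoc)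
      also have "\<dots> = (transpose R ** F' ** transpose (transpose R)) $ p $ j * f s"
        unfolding bilinear_entry by (simp add: transpose_def sum_distrib_left mult_ac)
      finally show ?thesis by (simp add: F_R)
    qed
    then have "(\<Sum>p\<in>UNIV. G $ i $ p * (?T (2, j) (?T (1, p) f) s - inverse q * ?T (1, j) (?T (2, p) f) s))
        = (G ** F) $ i $ j * f s"
      by (simp add: matrix_matrix_mult_def sum_distrib_right mult.assoc)
    then show "(\<Sum>l\<in>UNIV. \<Sum>k\<in>UNIV. \<Sum>p\<in>UNIV.
        matrix_inv F $ i $ p * E_mat q $ k $ l * ?T (l, j) (?T (k, p) f) s) = of_bool (i = j) * f s"
      by (simp add: sum_2 E_mat_entries G_F mat_def algebra_simps sum_subtractf sum_negf flip: G_def)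
  next
    fix i j :: 2 and f s assume s: "s \<in> {m. normal m}"
    have "(\<Sum>k\<in>UNIV. \<Sum>p\<in>UNIV. \<Sum>l\<in>UNIV.
        G $ l $ p * E_mat q $ k $ j * ?T (k, p) (?T (i, l) f) s)
      = (\<Sum>k\<in>UNIV. E_mat q $ k $ j * (\<Sum>p\<in>UNIV. \<Sum>l\<in>UNIV. G $ l $ p * ?T (k, p) (?T (i, l) f) s))"
      by (simp add: sum_distrib_left mult_ac)
    also have "\<dots> = (\<Sum>k\<in>UNIV. E_mat q $ k $ j * (\<Sum>a\<in>UNIV. \<Sum>b\<in>UNIV. G' $ a $ b * Z k b (Z i a f) s))"
      by (simp only: base_change_contract[OF lin] G'_def)
    also have "\<dots> = of_bool (i = j) * f s"
      using s \<open>q \<noteq> 0\<close> exhaust_2[of i] exhaust_2[of j]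
      by (auto simp: sum_2 E_mat_entries Z XGX XGY YGX YGY)
    finally show "(\<Sum>k\<in>UNIV. \<Sum>p\<in>UNIV. \<Sum>l\<in>UNIV.
        matrix_inv F $ l $ p * E_mat q $ k $ j * ?T (k, p) (?T (i, l) f) s) = of_bool (i = j) * f s"
      by (simp only: G_def)
  qed
qed

end
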